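(* For every $\delta>0$ there is a constant $K_\delta>0$ such that for all integers $N\ge 1$, \[ \#3\mathrm{iet}(N)\;\ge\;\frac{17}{48\pi^2}N^4 - K_\delta N^{3+\delta}. \]
   Context: For $\varepsilon\in(0,1)\setminus\mathbb{Q}$ and $\ell$ with $\max\{\varepsilon,1-\varepsilon\}<\ell<1$, define $T_{\varepsilon,\ell}:[0,\ell)\to[0,\ell)$ by $T_{\varepsilon,\ell}(x)=x+1-\varepsilon$ on $I_A=[0,\ell-1+\varepsilon)$, $T_{\varepsilon,\ell}(x)=x+1-2\varepsilon$ on $I_B=[\ell-1+\varepsilon,\varepsilon)$, and $T_{\varepsilon,\ell}(x)=x-\varepsilon$ on $I_C=[\varepsilon,\ell)$. For $x_0\in[0,\ell)$, the 3iet word $u_{\varepsilon,\ell,x_0}=(u_n)_{n\in\mathbb{Z}}\in\{A,B,C\}^{\mathbb{Z}}$ is given by $u_n=X$ iff $T_{\varepsilon,\ell}^n(x_0)\in I_X$, $X\in\{A,B,C\}$. A 3iet factor is a finite word occurring (as a block of consecutive letters) in some 3iet word for some admissible $\varepsilon,\ell,x_0$. $3\mathrm{iet}(N)$ denotes the set of all 3iet factors of length $N$. *)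

theory Defs
  imports Complex_Main
begin

datatype letter = A | B | C

definition T3 :: "real \<Rightarrow> real \<Rightarrow> real \<Rightarrow> real" where
  "T3 eps l x = (if 0 \<le> x \<and> x < l - 1 + eps then x + 1 - eps
                 else if l - 1 + eps \<le> x \<and> x < eps then x + 1 - 2 * eps
                 else x - eps)"

definition letter_of :: "real \<Rightarrow> real \<Rightarrow> real \<Rightarrow> letter" where
  "letter_of eps l x = (if 0 \<le> x \<and> x < l - 1 + eps then A
                        else if l - 1 + eps \<le> x \<and> x < eps then B
                        else C)"

definition T3_iter :: "real \<Rightarrow> real \<Rightarrow> int \<Rightarrow> real \<Rightarrow> real" where
  "T3_iter eps l n = (if 0 \<le> n then (T3 eps l) ^^ nat n
                      else (the_inv_into {0..<l} (T3 eps l)) ^^ nat (- n))"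

definition iet_word :: "real \<Rightarrow> real \<Rightarrow> real \<Rightarrow> int \<Rightarrow> letter" where
  "iet_word eps l x0 n = letter_of eps l (T3_iter eps l n x0)"

definition admissible :: "real \<Rightarrow> real \<Rightarrow> real \<Rightarrow> bool" where
  "admissible eps l x0 \<longleftrightarrow> 0 < eps \<and> eps < 1 \<and> eps \<notin> \<rat> \<and>
     max eps (1 - eps) < l \<and> l < 1 \<and> 0 \<le> x0 \<and> x0 < l"

definition iet3 :: "nat \<Rightarrow> letter list set" where
  "iet3 N = {w. \<exists>eps l x0 k. admissible eps l x0 \<and>
                   w = map (\<lambda>i. iet_word eps l x0 (k + int i)) [0..<N]}"

end

theory Submission
  imports Defs "HOL-Analysis.Complex_Transcendental"
begin

text \<open>
  \<open>T\<^bsub>eps,l\<^esub>\<close> is the first return map to \<open>[0, l)\<close> of the rotation by \<open>-eps\<close>. Take \<open>eps\<close>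
  slightly above a reduced fraction \<open>p/q\<close> and \<open>l = (L - 1/2)/q\<close>, with \<open>max p (q - p) < L \<le> q\<close>.
  Starting just above 0, the orbit runs through the \<open>L\<close> points near \<open>0, 1/q, \<dots>, (L - 1)/q\<close> and
  then jumps over the gap at 0, which costs a letter \<open>B\<close>. If this factor is placed at position
  \<open>r \<le> N - L\<close> of a word of length \<open>N\<close>, then it forces \<open>p/q < eps'\<close> for every realization of the
  word by a parameter \<open>eps'\<close>, so the word determines \<open>p/q\<close> as the largest fraction with that
  property; then \<open>r\<close> and \<open>L\<close> can be read off too. The reversals of these words are again 3iet
  factors, and they are new because the orbits stay away from \<open>l\<close>. The pairs \<open>(p, q - p)\<close> are the
  coprime pairs in a triangle, at least about \<open>19/80 * (L - 1)\<^sup>2\<close> of them, whence at least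
  \<open>19/480 * N^4 - O(N^3)\<close> words, and \<open>19/480 > 17/(48 * pi\<^sup>2)\<close>.
\<close>

text \<open>\<open>steps\<close> counts the rotation steps made by one application of \<open>T\<close>, and \<open>up\<close> those that wrap
  around 0.\<close>

fun up :: "letter \<Rightarrow> nat" where
  "up A = 1" | "up B = 1" | "up C = 0"

fun steps :: "letter \<Rightarrow> nat" where
  "steps A = 1" | "steps B = 2" | "steps C = 1"

lemma steps_pos: "0 < steps c"
  by (cases c) auto

section \<open>Words of finite forward orbits, and rotation counts over their factors\<close>

definition orbit_word :: "real \<Rightarrow> real \<Rightarrow> real \<Rightarrow> nat \<Rightarrow> letter list" where
  "orbit_word eps l x n = map (\<lambda>i. letter_of eps l ((T3 eps l ^^ i) x)) [0..<n]"

lemma length_orbit_word [simp]: "length (orbit_word eps l x n) = n"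
  by (simp add: orbit_word_def)

lemma orbit_word_nth [simp]:
  "i < n \<Longrightarrow> orbit_word eps l x n ! i = letter_of eps l ((T3 eps l ^^ i) x)"
  by (simp add: orbit_word_def)

lemma orbit_word_in_iet3:
  assumes "admissible eps l x"
  shows "orbit_word eps l x n \<in> iet3 n"
  unfolding iet3_def orbit_word_def iet_word_def T3_iter_def
  using assms by (intro CollectI exI[of _ eps] exI[of _ l] exI[of _ x] exI[of _ 0]) simp

definition ups :: "letter list \<Rightarrow> nat \<Rightarrow> nat \<Rightarrow> nat" where
  "ups w i j = (\<Sum>k\<in>{i..<j}. up (w ! k))"

definition stepss :: "letter list \<Rightarrow> nat \<Rightarrow> nat \<Rightarrow> nat" where
  "stepss w i j = (\<Sum>k\<in>{i..<j}. steps (w ! k))"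

lemma ups_Suc: "i \<le> j \<Longrightarrow> ups w i (Suc j) = ups w i j + up (w ! j)"
  and stepss_Suc: "i \<le> j \<Longrightarrow> stepss w i (Suc j) = stepss w i j + steps (w ! j)"
  by (simp_all add: ups_def stepss_def)

lemma stepss_Suc_left: "i < j \<Longrightarrow> stepss w i j = steps (w ! i) + stepss w (Suc i) j"
  by (simp add: stepss_def sum.atLeast_Suc_lessThan)

lemma stepss_le: "stepss w i j \<le> 2 * (j - i)"
proof -
  have "steps c \<le> 2" for c by (cases c) auto
  then have "stepss w i j \<le> (\<Sum>k\<in>{i..<j}. 2)"
    unfolding stepss_def by (intro sum_mono) auto
  then show ?thesis by simp
qed

lemma stepss_strict_mono: "i \<le> j \<Longrightarrow> j < k \<Longrightarrow> stepss w i j < stepss w i k"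
proof -
  assume "i \<le> j" "j < k"
  then have "stepss w i k = stepss w i j + stepss w j k"
    unfolding stepss_def by (simp add: sum.atLeastLessThan_concat)
  moreover have "0 < stepss w j k"
    using \<open>j < k\<close> steps_pos by (simp add: stepss_Suc_left)
  ultimately show ?thesis by simp
qed

lemma ups_rev:
  assumes "r + L \<le> length w"
  shows "ups (rev w) r (r + L) = ups w (length w - (r + L)) (length w - r)"
  unfolding ups_def
  by (rule sum.reindex_bij_witness[of _ "\<lambda>i. length w - Suc i" "\<lambda>i. length w - Suc i"])
    (use assms in \<open>auto simp: rev_nth\<close>)

lemma stepss_rev:
  assumes "r + L \<le> length w"
  shows "stepss (rev w) r (r + L) = stepss w (length w - (r + L)) (length w - r)"
  unfolding stepss_def
  by (rule sum.reindex_bij_witness[of _ "\<lambda>i. length w - Suc i" "\<lambda>i. length w - Suc i"])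
    (use assms in \<open>auto simp: rev_nth\<close>)

text \<open>In any realization such a factor forces \<open>q * eps > p\<close> and starts at a point of
  \<open>[0, q * eps - p)\<close>: before its final \<open>B\<close> the orbit has moved by \<open>p - (q - 1) * eps\<close>, and the
  interval of \<open>B\<close> lies below \<open>eps\<close>.\<close>

definition marks :: "letter list \<Rightarrow> nat \<Rightarrow> nat \<Rightarrow> nat \<Rightarrow> nat \<Rightarrow> bool" where
  "marks w p q r L \<longleftrightarrow> 0 < L \<and> r + L \<le> length w \<and> w ! (r + L - 1) = B \<and>
     ups w r (r + L) = p + 1 \<and> stepss w r (r + L) = q + 1"

section \<open>The exchange \<open>T\<close> for fixed parameters, as an induced rotation\<close>

locale iet =
  fixes eps l :: real
  assumes eps_less: "eps < l" and one_minus_eps_less: "1 - eps < l" and l_less_1: "l < 1"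
begin

abbreviation "T \<equiv> T3 eps l"

lemma T_in: "x \<in> {0..<l} \<Longrightarrow> T x \<in> {0..<l}"
  using eps_less one_minus_eps_less l_less_1 by (auto simp: T3_def)

lemma T_eq: "T x = (x :: real) + up (letter_of eps l x) - steps (letter_of eps l x) * eps"
  by (auto simp: T3_def letter_of_def)

lemma letter_B: "x \<in> {0..<l} \<Longrightarrow> letter_of eps l x = B \<longleftrightarrow> l - 1 + eps \<le> x \<and> x < eps"
  using eps_less one_minus_eps_less l_less_1 by (auto simp: letter_of_def)

lemma T_surj:
  assumes "y \<in> {0..<l}"
  obtains x where "x \<in> {0..<l}" "T x = y"
proof -
  \<comment> \<open>The images of the intervals of \<open>C\<close>, \<open>B\<close> and
    \<open>A\<close>, in this order, tile \<open>[0, l)\<close>.\<close>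
  consider "y < l - eps" | "l - eps \<le> y" "y < 1 - eps" | "1 - eps \<le> y" by linarith
  then show ?thesis
  proof cases
    case 1
    show ?thesis by (rule that[of "y + eps"])
      (use 1 assms eps_less one_minus_eps_less l_less_1 in \<open>auto simp: T3_def\<close>)
  next
    case 2
    show ?thesis by (rule that[of "y - 1 + 2 * eps"])
      (use 2 assms eps_less one_minus_eps_less l_less_1 in \<open>auto simp: T3_def\<close>)
  next
    case 3
    show ?thesis by (rule that[of "y - 1 + eps"])
      (use 3 assms eps_less one_minus_eps_less l_less_1 in \<open>auto simp: T3_def\<close>)
  qed
qed

lemma T_pow_surj:
  assumes "y \<in> {0..<l}"
  shows "\<exists>x\<in>{0..<l}. (T ^^ n) x = y"
proof (induction n)
  case 0
  then show ?case using assms by auto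
next
  case (Suc n)
  then obtain x where x: "x \<in> {0..<l}" "(T ^^ n) x = y" by blast
  from T_surj[OF x(1)] obtain z where "z \<in> {0..<l}" "T z = x" .
  then show ?case using x by (auto simp: funpow_swap1 intro!: bexI[of _ z])
qed

lemma T_pow_in: "x \<in> {0..<l} \<Longrightarrow> (T ^^ n) x \<in> {0..<l}"
  by (induction n) (auto simp del: atLeastLessThan_iff intro: T_in)

lemma orbit_displacement:
  assumes "i \<le> j" "j \<le> n"
  shows "(T ^^ j) x = (T ^^ i) x + ups (orbit_word eps l x n) i j - stepss (orbit_word eps l x n) i j * eps"
  using assms
proof (induction j rule: dec_induct)
  case base
  then show ?case by (simp add: ups_def stepss_def)
next
  case (step j)
  have "(T ^^ Suc j) x = (T ^^ j) x + up (orbit_word eps l x n ! j) - steps (orbit_word eps l x n ! j) * eps"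
    using step.prems T_eq[of "(T ^^ j) x"] by simp
  moreover have "real (ups (orbit_word eps l x n) i (Suc j)) =
      ups (orbit_word eps l x n) i j + up (orbit_word eps l x n ! j)"
    using step.hyps(1) by (simp add: ups_Suc)
  moreover have "real (stepss (orbit_word eps l x n) i (Suc j)) * eps =
      stepss (orbit_word eps l x n) i j * eps + steps (orbit_word eps l x n ! j) * eps"
    using step.hyps(1) by (simp add: stepss_Suc distrib_right)
  ultimately show ?case using step.IH step.prems by linarith
qed

lemma marks_bounds:
  assumes x: "x \<in> {0..<l}" and m: "marks (orbit_word eps l x n) p q r L"
  shows "(T ^^ r) x < q * eps - p"
proof -
  define y where "y i = (T ^^ i) x" for i
  have yin: "y i \<in> {0..<l}" for i unfolding y_def by (rule T_pow_in[OF x])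
  let ?w = "orbit_word eps l x n"
  let ?e = "r + L - 1"
  have e: "Suc ?e = r + L" "r \<le> ?e" "?e < n" and B: "?w ! ?e = B"
    using m by (auto simp: marks_def)
  have "ups ?w r ?e = p" "stepss ?w r ?e + 1 = q"
    using m ups_Suc[OF e(2), of ?w] stepss_Suc[OF e(2), of ?w] e B by (auto simp: marks_def)
  then have "y ?e = y r + p - (q - 1) * eps" "1 \<le> q"
    using orbit_displacement[OF e(2), of n x] e unfolding y_def by auto
  moreover have "y ?e < eps"
    using B e letter_B[OF yin] by (auto simp: y_def)
  ultimately show ?thesis unfolding y_def by (simp add: algebra_simps)
qed

text \<open>Read in the original direction, the factor begins with its \<open>B\<close>, hence at a
  point at or above \<open>l - 1 + eps\<close>. As a whole it moves the orbit by
  \<open>p + 1 - (q + 1) * eps\<close>, so it ends within \<open>q * eps - p\<close> of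
  \<open>l\<close>.\<close>

lemma marks_rev_bounds:
  assumes x: "x \<in> {0..<l}" and m: "marks (rev (orbit_word eps l x n)) p q r L"
  obtains i where "i \<le> n" "l - (q * eps - p) \<le> (T ^^ i) x"
proof -
  define y where "y i = (T ^^ i) x" for i
  have yin: "y i \<in> {0..<l}" for i unfolding y_def by (rule T_pow_in[OF x])
  let ?w = "orbit_word eps l x n"
  let ?s = "n - (r + L)" and ?e = "n - r"
  have e: "?s < ?e" "?e \<le> n" "r + L - 1 < n" "n - Suc (r + L - 1) = ?s" and L: "r + L \<le> length ?w"
    using m by (auto simp: marks_def)
  have B: "?w ! ?s = B" using m e by (simp add: marks_def rev_nth)
  have "ups ?w ?s ?e = p + 1" "stepss ?w ?s ?e = q + 1"
    using m L by (auto simp: marks_def ups_rev stepss_rev)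
  then have "y ?e = y ?s + (p + 1) - (q + 1) * eps"
    using orbit_displacement[of ?s ?e n x] e unfolding y_def by auto
  moreover have "l - 1 + eps \<le> y ?s"
    using B e letter_B[OF yin] by (auto simp: y_def)
  ultimately show ?thesis using that[of ?e] unfolding y_def by (simp add: algebra_simps)
qed

text \<open>The map from \<open>y\<close> to \<open>l - T y\<close> flips each of the three
  intervals about its midpoint, so reflection in \<open>l / 2\<close> conjugates \<open>T\<close> to
  its inverse. The left endpoints are excluded because the half-open intervals do not contain their
  mirror images.\<close>

lemma T_reflect:
  assumes "y \<in> {0..<l}" "y \<notin> {0, l - 1 + eps, eps}"
  shows "letter_of eps l (l - T y) = letter_of eps l y" "T (l - T y) = l - y"
  using assms eps_less one_minus_eps_less l_less_1 by (auto simp: T3_def letter_of_def)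

lemma rev_orbit_word:
  assumes x: "x \<in> {0..<l}" and avoid: "\<And>i. i \<le> n \<Longrightarrow> (T ^^ i) x \<notin> {0, l - 1 + eps, eps}"
  shows "rev (orbit_word eps l x n) = orbit_word eps l (l - (T ^^ n) x) n"
proof -
  have iter: "(T ^^ i) (l - (T ^^ n) x) = l - (T ^^ (n - i)) x" if "i \<le> n" for i
    using that
  proof (induction i)
    case (Suc i)
    then have "(T ^^ Suc i) (l - (T ^^ n) x) = T (l - (T ^^ Suc (n - Suc i)) x)"
      by (simp add: Suc_diff_Suc)
    also have "\<dots> = l - (T ^^ (n - Suc i)) x"
      using T_reflect(2)[OF T_pow_in[OF x] avoid, of "n - Suc i"] by simp
    finally show ?case .
  qed simp
  show ?thesis
  proof (rule nth_equalityI)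
    fix i assume "i < length (rev (orbit_word eps l x n))"
    then have i: "i < n" by simp
    then have "(T ^^ i) (l - (T ^^ n) x) = l - T ((T ^^ (n - Suc i)) x)"
      using iter[of i] by (metis Suc_diff_Suc comp_apply funpow.simps(2) less_imp_le)
    then show "rev (orbit_word eps l x n) ! i = orbit_word eps l (l - (T ^^ n) x) n ! i"
      using i T_reflect(1)[OF T_pow_in[OF x] avoid, of "n - Suc i"] by (simp add: rev_nth)
  qed simp
qed

lemma frac_orbit:
  assumes x: "x \<in> {0..<l}" and "j \<le> n"
  shows "frac (x - stepss (orbit_word eps l x n) 0 j * eps) = (T ^^ j) x"
proof -
  have "x - stepss (orbit_word eps l x n) 0 j * eps - (T ^^ j) x = - of_nat (ups (orbit_word eps l x n) 0 j)"
    using orbit_displacement[of 0 j n x] assms by simp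
  then have "x - stepss (orbit_word eps l x n) 0 j * eps - (T ^^ j) x \<in> \<int>"
    by (metis Ints_minus Ints_of_nat)
  then show ?thesis
    using T_pow_in[OF x, of j] l_less_1 by (auto simp: frac_unique_iff)
qed

text \<open>This is the first return property in counting form: \<open>T\<close> meets every
  rotation point in \<open>[0, l)\<close>, one per letter, and the only points passed over are those
  skipped by a \<open>B\<close>.\<close>

lemma card_rotation_visits:
  assumes x: "x \<in> {0..<l}" and "j \<le> n"
  shows "card {k. k < stepss (orbit_word eps l x n) 0 j \<and> frac (x - real k * eps) < l} = j"
  using assms(2)
proof (induction j)
  case 0
  then show ?case by (simp add: stepss_def)
next
  case (Suc j)
  define s where "s = stepss (orbit_word eps l x n) 0 j"
  define c where "c = letter_of eps l ((T ^^ j) x)"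
  define V where "V m = {k. k < m \<and> frac (x - real k * eps) < l}" for m :: nat
  have fin: "finite (V m)" for m unfolding V_def by simp
  have yin: "(T ^^ j) x \<in> {0..<l}" by (rule T_pow_in[OF x])
  have fr: "frac (x - real s * eps) = (T ^^ j) x"
    unfolding s_def using Suc.prems by (intro frac_orbit[OF x]) simp
  have "V (Suc s) = insert s (V s)"
    using fr yin by (auto simp: V_def less_Suc_eq)
  moreover have "card (V s) = j" using Suc by (simp add: V_def s_def)
  ultimately have *: "card (V (Suc s)) = Suc j"
    using fin[of s] by (simp add: V_def)
  have "V (s + steps c) = V (Suc s)"
  proof (cases c)
    case B
    then have b: "l - 1 + eps \<le> (T ^^ j) x" "(T ^^ j) x < eps"
      using letter_B[OF yin] by (auto simp: c_def)
    \<comment> \<open>The intermediate rotation point of a \<open>B\<close> wraps around 0 and lands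
      in the gap \<open>[l, 1)\<close>.\<close>
    have "frac (x - real (Suc s) * eps) = (T ^^ j) x - eps + 1"
    proof -
      have "(x - real (Suc s) * eps) - ((T ^^ j) x - eps + 1) = x - real s * eps - frac (x - real s * eps) - 1"
        using fr by (simp add: algebra_simps)
      also have "\<dots> = of_int (\<lfloor>x - real s * eps\<rfloor> - 1)" by (simp add: frac_def)
      finally have "(x - real (Suc s) * eps) - ((T ^^ j) x - eps + 1) \<in> \<int>" by (metis Ints_of_int)
      then show ?thesis using b yin eps_less one_minus_eps_less l_less_1 by (auto simp: frac_unique_iff)
    qed
    then have "\<not> frac (x - real (Suc s) * eps) < l" using b by simp
    then show ?thesis using B by (auto simp: V_def less_Suc_eq)
  qed auto
  then show ?case
    using * Suc.prems by (simp add: V_def s_def c_def stepss_Suc)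
qed

end

section \<open>Arithmetic facts: irrationality of \<open>sqrt 2\<close>, and multiples modulo
  \<open>q\<close>\<close>

lemma sqrt_2_irrational: "sqrt 2 \<notin> \<rat>"
proof
  assume "sqrt 2 \<in> \<rat>"
  then obtain m n :: nat where n: "n \<noteq> 0" and "\<bar>sqrt 2\<bar> = real m / real n" and mn: "coprime m n"
    by (rule Rats_abs_nat_div_natE)
  then have "real m = sqrt 2 * real n" by (simp add: field_simps)
  then have "real (m\<^sup>2) = real (2 * n\<^sup>2)" by (simp add: power_mult_distrib)
  then have eq: "m\<^sup>2 = 2 * n\<^sup>2" by linarith
  then have "even (m\<^sup>2)" by simp
  then have "even m" by simp
  then obtain k where "m = 2 * k" ..
  with eq have "n\<^sup>2 = 2 * k\<^sup>2" by (simp add: power2_eq_square)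
  then have "even (n\<^sup>2)" by simp
  then have "even n" by simp
  with \<open>even m\<close> mn show False using coprime_common_divisor[of m n 2] by simp
qed

text \<open>Multiplication by \<open>-p\<close> permutes the residues modulo \<open>q\<close>. This
  will count the visits of the rational rotation to \<open>[0, L / q)\<close>.\<close>

lemma card_mult_mod_less:
  fixes p q L :: nat
  assumes "coprime p q" "L \<le> q"
  shows "card {k. k < q \<and> (- (int k * int p)) mod int q < int L} = L"
proof (cases "q = 0")
  case True
  then show ?thesis using assms by simp
next
  case False
  define f where "f k = nat ((- (int k * int p)) mod int q)" for k :: nat
  have f_int: "int (f k) = (- (int k * int p)) mod int q" for k
    using False by (simp add: f_def)
  have f_less: "f k < q" for k
    using False f_int[of k] by (metis of_nat_less_iff pos_mod_bound of_nat_0_less_iff gr0I)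
  have inj: "inj_on f {..<q}"
  proof (rule inj_onI)
    fix i j assume ij: "i \<in> {..<q}" "j \<in> {..<q}" "f i = f j"
    then have "(- (int i * int p)) mod int q = (- (int j * int p)) mod int q"
      using f_int by metis
    then have "int q dvd (- (int i * int p)) - (- (int j * int p))"
      by (simp add: mod_eq_dvd_iff)
    then have "int q dvd (int j - int i) * int p" by (simp add: algebra_simps)
    then have "int q dvd int j - int i"
      using assms(1) by (simp add: coprime_dvd_mult_left_iff coprime_commute)
    then show "i = j"
      using ij dvd_imp_le_int[of "int j - int i" "int q"] by (cases "i = j") auto
  qed
  have "f ` {..<q} = {..<q}"
    using f_less inj by (intro endo_inj_surj) auto
  then have "bij_betw f {..<q} {..<q}" using inj by (simp add: bij_betw_def)
  then have "bij_betw f {k \<in> {..<q}. f k < L} {j \<in> {..<q}. j < L}"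
    by (rule bij_betw_subset) (use \<open>f ` {..<q} = {..<q}\<close> in auto)
  then have "card {k \<in> {..<q}. f k < L} = card {j \<in> {..<q}. j < L}" by (rule bij_betw_same_card)
  moreover have "{j \<in> {..<q}. j < L} = {..<L}" using assms by auto
  moreover have "{k \<in> {..<q}. f k < L} = {k. k < q \<and> (- (int k * int p)) mod int q < int L}"
    using f_int by (auto simp flip: f_int)
  ultimately show ?thesis by simp
qed

section \<open>Parameters just above a reduced fraction\<close>

locale near_rational =
  fixes N L p q :: nat
  assumes cop: "coprime p q" and p_pos: "0 < p" and p_less: "p < L" and p_q: "p < q"
    and q_less: "q < p + L" and L_le_q: "L \<le> q" and L_le_N: "L \<le> N"
begin

definition "mesh = 1 / real q"
text \<open>The starting point \<open>th\<close> is rational while \<open>eta\<close> is an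
  irrational multiple of it, which keeps orbits off the endpoints of the intervals. Both are small
  enough for all orbit points of a word of length \<open>N\<close> to stay near multiples of
  \<open>mesh\<close>.\<close>

definition "th = 1 / (100 * (real N)\<^sup>2)"
definition "eta = sqrt 2 * th"
definition "eps = real p / real q + eta"
text \<open>The shift by half a mesh puts \<open>len\<close> midway between two multiples of
  \<open>mesh\<close>, so that small perturbations move no point across it.\<close>

definition "len = (real L - 1 / 2) / real q"

lemma q_pos: "0 < q" and N_pos: "0 < N" and q_le: "q < 2 * N"
  using p_pos p_less p_q q_less L_le_N by auto

lemma th_pos: "0 < th" using N_pos by (simp add: th_def)

lemma th_less_eta: "th < eta"
  using th_pos real_less_rsqrt[of 1 2] by (simp add: eta_def)

text \<open>A word of length \<open>N\<close> makes at most \<open>2 * N\<close> rotation steps.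
  With \<open>eta \<le> 3 / 2 * th\<close> their total drift is at most
  \<open>3 / (100 * N)\<close>, which is below \<open>1 / (16 * q)\<close> because
  \<open>q < 2 * N\<close>.\<close>

lemma small_perturbation:
  assumes "\<bar>n\<bar> \<le> 2 * real N"
  shows "\<bar>n * eta\<bar> \<le> mesh / 16" "th \<le> mesh / 16"
proof -
  have "sqrt 2 \<le> 3 / 2" by (rule real_le_lsqrt) (auto simp: power2_eq_square)
  then have "eta \<le> 3 / 2 * th" using th_pos by (simp add: eta_def)
  moreover have "0 < eta" using th_pos th_less_eta by simp
  ultimately have "\<bar>n * eta\<bar> \<le> 2 * real N * (3 / 2 * th)"
    unfolding abs_mult using assms by (intro mult_mono) auto
  also have "\<dots> = 3 / (100 * real N)" using N_pos by (simp add: th_def power2_eq_square field_simps)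
  also have "\<dots> \<le> mesh / 16" using q_le N_pos q_pos by (simp add: mesh_def field_simps)
  finally show "\<bar>n * eta\<bar> \<le> mesh / 16" .
  have "th \<le> 1 / (100 * real N)" using N_pos by (simp add: th_def power2_eq_square field_simps)
  also have "\<dots> \<le> mesh / 16" using q_le N_pos q_pos by (simp add: mesh_def field_simps)
  finally show "th \<le> mesh / 16" .
qed

lemma mesh_pos: "0 < mesh" using q_pos by (simp add: mesh_def)

lemma len_eq: "len = real L / real q - mesh / 2"
  by (simp add: len_def mesh_def diff_divide_distrib)

lemma len_le: "len \<le> 1 - mesh / 2"
proof -
  have "real L / real q \<le> 1" using L_le_q q_pos by simp
  then show ?thesis by (simp add: len_eq)
qed

text \<open>The integer inequalities \<open>p < L\<close> and \<open>q < p + L\<close> leave room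
  for a full mesh. This outweighs the half mesh removed in \<open>len\<close> and the shift by
  \<open>eta\<close>.\<close>

lemma fractions_le:
  "real p / real q + mesh \<le> real L / real q" "1 + mesh \<le> real p / real q + real L / real q"
proof -
  have "(real p + 1) / real q \<le> real L / real q"
    using p_less by (intro divide_right_mono) auto
  then show "real p / real q + mesh \<le> real L / real q" by (simp add: mesh_def add_divide_distrib)
  have "(real q + 1) / real q \<le> (real p + real L) / real q"
    using q_less by (intro divide_right_mono) auto
  then show "1 + mesh \<le> real p / real q + real L / real q" using q_pos by (simp add: mesh_def add_divide_distrib)
qed

sublocale iet eps len
proof
  have s: "\<bar>eta\<bar> \<le> mesh / 16" using small_perturbation(1)[of 1] N_pos by simp
  show "eps < len" using s fractions_le mesh_pos unfolding eps_def len_eq by linarith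
  show "1 - eps < len" using s fractions_le mesh_pos unfolding eps_def len_eq by linarith
  show "len < 1" using len_le mesh_pos by linarith
qed

lemma th_in: "th \<in> {0..<len}"
proof -
  have "0 \<le> real p / real q" "th \<le> mesh / 16" using small_perturbation(2)[of 0] by simp_all
  then have "th < len" using fractions_le(1) mesh_pos unfolding len_eq by linarith
  then show ?thesis using th_pos by simp
qed

lemma eps_irrational: "eps \<notin> \<rat>"
proof
  assume "eps \<in> \<rat>"
  then have "(eps - real p / real q) / th \<in> \<rat>"
    unfolding th_def by (intro Rats_divide Rats_diff) auto
  then show False using sqrt_2_irrational th_pos by (simp add: eps_def eta_def)
qed

lemma admissible: "x \<in> {0..<len} \<Longrightarrow> admissible eps len x"
  using eps_irrational eps_less one_minus_eps_less l_less_1 by (auto simp: admissible_def)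

text \<open>The perturbed rotation point stays within \<open>mesh / 8\<close> of its lattice point,
  whereas \<open>len\<close> is half a mesh away from the lattice.\<close>

lemma rotation_less_len_iff:
  assumes "k < q"
  shows "frac (th - real k * eps) < len \<longleftrightarrow> (- (int k * int p)) mod int q < int L"
\<comment> \<open>The residue 0 occurs only for \<open>k = 0\<close>, where the point is
  \<open>th\<close> itself. For other \<open>k\<close> the perturbation may be negative, but the
  lattice point is at least one mesh above 0.\<close>
proof (cases "k = 0")
  case True
  then show ?thesis using th_in l_less_1 p_less by (simp add: frac_eq[THEN iffD2])
next
  case False
  define j where "j = (- (int k * int p)) mod int q"
  define t where "t = (- (int k * int p)) div int q"
  have jt: "- (int k * int p) = j + int q * t" by (simp add: j_def t_def)
  have "j \<noteq> 0"
  proof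
    assume "j = 0"
    then have "int q dvd int k * int p" by (simp add: j_def mod_eq_0_iff_dvd)
    then have "q dvd k" using cop
      by (metis coprime_commute coprime_dvd_mult_left_iff of_nat_dvd_iff of_nat_mult)
    then show False using assms False by (simp add: nat_dvd_not_less)
  qed
  moreover have "0 \<le> j" "j < int q" using q_pos by (simp_all add: j_def)
  ultimately have j: "1 \<le> j" "j \<le> int q - 1" by auto
  define d where "d = th - real k * eta"
  have d: "\<bar>d\<bar> \<le> mesh / 8"
    using small_perturbation[of "real k"] assms q_le th_pos unfolding d_def abs_le_iff by auto
  have "real k * real p = - (of_int j + real q * of_int t)"
    using arg_cong[OF jt, of real_of_int] by simp
  then have "real k * real p / real q = - (of_int j / real q) - of_int t"
    using q_pos by (simp add: field_simps)
  then have eq: "th - real k * eps = of_int j / real q + d + of_int t"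
    by (simp add: eps_def d_def distrib_left)
  have "mesh \<le> of_int j / real q"
    unfolding mesh_def using j by (intro divide_right_mono) auto
  moreover have "of_int j / real q \<le> (real q - 1) / real q"
    using j by (intro divide_right_mono) linarith+
  then have "of_int j / real q \<le> 1 - mesh" using q_pos by (simp add: mesh_def diff_divide_distrib)
  ultimately have "0 \<le> of_int j / real q + d" "of_int j / real q + d < 1"
    using d mesh_pos unfolding abs_le_iff by linarith+
  then have fr: "frac (th - real k * eps) = of_int j / real q + d"
    using eq by (simp add: frac_unique_iff)
  show ?thesis
  proof (cases "j < int L")
    case True
    then have "of_int j / real q \<le> (real L - 1) / real q"
      by (intro divide_right_mono) linarith+
    then have "of_int j / real q \<le> real L / real q - mesh" by (simp add: mesh_def diff_divide_distrib)
    then have "of_int j / real q + d < len" using d mesh_pos unfolding len_eq abs_le_iff by linarith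
    then show ?thesis using True fr by (simp add: j_def)
  next
    case False
    then have "real L / real q \<le> of_int j / real q"
      by (intro divide_right_mono) linarith+
    then have "\<not> of_int j / real q + d < len" using d mesh_pos unfolding len_eq abs_le_iff by linarith
    then show ?thesis using False fr by (simp add: j_def)
  qed
qed

end

section \<open>The first return factor and its placement inside a longer word\<close>

lemma funpow_diff_funpow: "m \<le> n \<Longrightarrow> (f ^^ (n - m)) ((f ^^ m) x) = (f ^^ n) x"
  by (metis comp_apply funpow_add le_add_diff_inverse2)

lemma orbit_word_shift:
  assumes "r + j \<le> n" "j \<le> m"
  shows "stepss (orbit_word e l x n) r (r + j) = stepss (orbit_word e l ((T3 e l ^^ r) x) m) 0 j"
    "ups (orbit_word e l x n) r (r + j) = ups (orbit_word e l ((T3 e l ^^ r) x) m) 0 j"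
  unfolding stepss_def ups_def using assms
  by (auto intro!: sum.reindex_bij_witness[of _ "\<lambda>i. i + r" "\<lambda>i. i - r"] simp: funpow_diff_funpow)

context near_rational begin

lemma q_mult_eta: "q * eps - p = q * eta" "q * eta \<le> mesh / 16" "th < q * eta"
proof -
  show "q * eps - p = q * eta" using q_pos by (simp add: eps_def field_simps)
  show "q * eta \<le> mesh / 16" using small_perturbation(1)[of q] q_le by auto
  have "1 * eta \<le> q * eta" using q_pos th_pos th_less_eta by (intro mult_right_mono) auto
  then show "th < q * eta" using th_less_eta by simp
qed

text \<open>Exactly \<open>L\<close> of the first \<open>q\<close> rotation points lie in
  \<open>[0, len)\<close>, so \<open>L\<close> letters use them all up. Point number
  \<open>q\<close> falls into the gap, so the last letter has to step over it and is a
  \<open>B\<close>.\<close>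

lemma first_return:
  fixes w
  defines "w \<equiv> orbit_word eps len th L"
  shows "w ! (L - 1) = B" "stepss w 0 L = q + 1" "ups w 0 L = p + 1"
proof -
  define V where "V m = {k. k < m \<and> frac (th - real k * eps) < len}" for m :: nat
  have fin: "finite (V m)" for m unfolding V_def by simp
  have V_mono: "card (V m) \<le> card (V m')" if "m \<le> m'" for m m'
    using that by (intro card_mono fin) (auto simp: V_def)
  have card_q: "card (V q) = L"
  proof -
    have "V q = {k. k < q \<and> (- (int k * int p)) mod int q < int L}"
      unfolding V_def using rotation_less_len_iff by auto
    then show ?thesis using card_mult_mod_less[OF cop L_le_q] by simp
  qed
  have card_S: "card (V (stepss w 0 j)) = j" if "j \<le> L" for j
    using card_rotation_visits[OF th_in that] by (simp add: V_def w_def)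
  have fr_S: "frac (th - stepss w 0 j * eps) < len" if "j \<le> L" for j
    using frac_orbit[OF th_in that] T_pow_in[OF th_in, of j] by (simp add: w_def)
  have L_pos: "0 < L" using p_less by simp
  \<comment> \<open>After \<open>q\<close> rotations the point is \<open>th - q * eta\<close> modulo
    1. It lies just below 1, since \<open>th < q * eta\<close>.\<close>
  have "(th - real q * eps) - (1 + th - q * eta) = - real (p + 1)"
    using q_mult_eta(1) by simp
  then have "(th - real q * eps) - (1 + th - q * eta) \<in> \<int>"
    using Ints_minus[OF Ints_of_nat[of "p + 1"]] by metis
  moreover have "0 \<le> 1 + th - q * eta" "1 + th - q * eta < 1" "len \<le> 1 + th - q * eta"
    using q_mult_eta th_pos len_le mesh_pos th_in by auto
  ultimately have "\<not> frac (th - real q * eps) < len"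
    by (metis frac_unique_iff not_less)
  then have "stepss w 0 L \<noteq> q" using fr_S[of L] by auto
  \<comment> \<open>Otherwise the point reached after \<open>L\<close> letters would be visit number
    \<open>L + 1\<close> among the first \<open>q\<close> rotation points.\<close>
  moreover have "\<not> stepss w 0 L < q"
  proof
    assume less: "stepss w 0 L < q"
    have "V (Suc (stepss w 0 L)) = insert (stepss w 0 L) (V (stepss w 0 L))"
      using fr_S[of L] by (auto simp: V_def less_Suc_eq)
    then have "card (V (Suc (stepss w 0 L))) = Suc L"
      using fin card_S[of L] by (simp add: V_def)
    then show False using V_mono[of "Suc (stepss w 0 L)" q] less card_q by simp
  qed
  moreover have "stepss w 0 (L - 1) < q"
    using V_mono[of q "stepss w 0 (L - 1)"] card_q card_S[of "L - 1"] L_pos by (cases "stepss w 0 (L - 1) < q") auto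
  moreover have S: "stepss w 0 L = stepss w 0 (L - 1) + steps (w ! (L - 1))"
    and U: "ups w 0 L = ups w 0 (L - 1) + up (w ! (L - 1))"
    using L_pos stepss_Suc[of 0 "L - 1" w] ups_Suc[of 0 "L - 1" w] by simp_all
  ultimately show B: "w ! (L - 1) = B" and Sq: "stepss w 0 L = q + 1"
    by (cases "w ! (L - 1)"; simp)+
  have yin: "(T ^^ (L - 1)) th \<in> {0..<len}" by (rule T_pow_in[OF th_in])
  have "real (stepss w 0 (L - 1)) = real q - 1" using S Sq B by simp
  then have "(T ^^ (L - 1)) th = th + ups w 0 (L - 1) - (real q - 1) * eps"
    using orbit_displacement[of 0 "L - 1" L th] by (simp add: w_def)
  also have "\<dots> = th + ups w 0 (L - 1) - q * eps + eps" by (simp add: algebra_simps)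
  finally have "(T ^^ (L - 1)) th = th + ups w 0 (L - 1) - p - q * eta + eps"
    using q_mult_eta(1) by simp
  moreover have "len - 1 + eps \<le> (T ^^ (L - 1)) th" "(T ^^ (L - 1)) th < eps"
    using B letter_B[OF yin] L_pos by (auto simp: w_def)
  \<comment> \<open>The interval of \<open>B\<close> is shorter than 1, which leaves a single
    integer for the count.\<close>
  ultimately have "real (ups w 0 (L - 1)) < p + 1" "real (ups w 0 (L - 1)) > real p - 1"
    using q_mult_eta th_in th_pos mesh_pos eps_less len_le p_pos fractions_le(1) by auto
  then show "ups w 0 L = p + 1" using U B by simp
qed

text \<open>Starting \<open>r\<close> steps before \<open>th\<close> places the first return factor
  at position \<open>r\<close> of a forward orbit, so the inverse map in \<open>T3_iter\<close>
  never has to be evaluated.\<close>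

definition "start r = (SOME x. x \<in> {0..<len} \<and> (T ^^ r) x = th)"

lemma start: "start r \<in> {0..<len}" "(T ^^ r) (start r) = th"
  using someI_ex[of "\<lambda>x. x \<in> {0..<len} \<and> (T ^^ r) x = th"] T_pow_surj[OF th_in, of r]
  unfolding start_def by blast+

definition "word r = orbit_word eps len (start r) N"

lemma word_in_iet3: "word r \<in> iet3 N"
  unfolding word_def by (intro orbit_word_in_iet3 admissible start)

lemma marks_word:
  assumes "r + L \<le> N"
  shows "marks (word r) p q r L"
proof -
  have "0 < L" using p_less by simp
  then have "word r ! (r + L - 1) = orbit_word eps len th L ! (L - 1)"
    using assms start(2)[of r] funpow_add[of "L - 1" r T] unfolding word_def
    by (simp add: add.commute)
  then show ?thesis
    using assms first_return orbit_word_shift[OF assms order_refl] start \<open>0 < L\<close>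
    by (simp add: marks_def word_def)
qed

section \<open>Orbit points as perturbed lattice points\<close>

lemma orbit_lattice:
  assumes "r \<le> N" "i \<le> N"
  obtains m n :: int where "\<bar>n\<bar> \<le> 2 * int N" "(T ^^ i) (start r) = th + m - n * eps" "n = 0 \<Longrightarrow> i = r"
proof (cases "i \<le> r")
  case True
  let ?w = "orbit_word eps len (start r) N"
  \<comment> \<open>Displacements are measured from position \<open>r\<close>, where the orbit is at
    \<open>th\<close>; before it both counts change sign. Every letter makes at least one step, so
    \<open>n = 0\<close> occurs only at \<open>r\<close>.\<close>
  have "(T ^^ i) (start r) = th + of_int (- int (ups ?w i r)) - of_int (- int (stepss ?w i r)) * eps"
    using orbit_displacement[OF True assms(1), of "start r"] start(2)[of r] by simp
  moreover have "\<bar>- int (stepss ?w i r)\<bar> \<le> 2 * int N" using stepss_le[of ?w i r] assms by simp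
  moreover have "i = r" if "- int (stepss ?w i r) = 0"
    using that True stepss_strict_mono[of i i r ?w] by (cases "i < r") auto
  ultimately show ?thesis using that by blast
next
  case False
  let ?w = "orbit_word eps len (start r) N"
  have "(T ^^ i) (start r) = th + of_int (int (ups ?w r i)) - of_int (int (stepss ?w r i)) * eps"
    using orbit_displacement[OF _ assms(2), of r "start r"] start(2)[of r] False by simp
  moreover have "\<bar>int (stepss ?w r i)\<bar> \<le> 2 * int N" using stepss_le[of ?w r i] assms by simp
  moreover have "i = r" if "int (stepss ?w r i) = 0"
    using that False stepss_strict_mono[of r r i ?w] by auto
  ultimately show ?thesis using that by blast
qed

lemma rational_multiple_eps: "a \<in> \<rat> \<Longrightarrow> a = of_int n * eps \<Longrightarrow> n = 0"
proof (rule ccontr)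
  assume "a \<in> \<rat>" "a = of_int n * eps" "n \<noteq> 0"
  then have "eps = a / of_int n" by simp
  then show False using eps_irrational \<open>a \<in> \<rat>\<close> by auto
qed

text \<open>At an endpoint, irrationality of \<open>eps\<close> would force its coefficient to
  vanish. Then \<open>th\<close> or \<open>len - th\<close> would be an integer, although
  \<open>0 < th < len < 1\<close>.\<close>

lemma orbit_avoids_endpoints:
  assumes "r \<le> N" "i \<le> N"
  shows "(T ^^ i) (start r) \<notin> {0, len - 1 + eps, eps}"
proof -
  obtain m n :: int where y: "(T ^^ i) (start r) = th + m - n * eps"
    using orbit_lattice[OF assms] by blast
  have th: "th \<in> \<rat>" "0 < th" "th < len" "th < 1" and len: "len \<in> \<rat>"
    proof -
    show "th \<in> \<rat>" "len \<in> \<rat>" by (simp_all add: th_def len_def)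
    show "0 < th" "th < len" "th < 1" using th_pos th_in l_less_1 by auto
  qed
  have no_int: "th \<noteq> - of_int k" for k :: int
    using th(2,4) by (metis of_int_minus of_int_0_less_iff of_int_less_1_iff zless_imp_add1_zle add_0 not_less)
  show ?thesis
  proof (intro notI, elim insertE emptyE)
    assume "(T ^^ i) (start r) = 0"
    then have *: "th + m = of_int n * eps" using y by simp
    have "n = 0" by (rule rational_multiple_eps[OF _ *]) (use th in simp)
    then show False using * no_int[of m] by simp
  next
    assume "(T ^^ i) (start r) = eps"
    then have *: "th + m = of_int (n + 1) * eps" using y by (simp add: algebra_simps)
    have "n + 1 = 0" by (rule rational_multiple_eps[OF _ *]) (use th in simp)
    then show False using * no_int[of m] by simp
  next
    assume "(T ^^ i) (start r) = len - 1 + eps"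
    then have *: "th + m - len + 1 = of_int (n + 1) * eps" using y by (simp add: algebra_simps)
    have "n + 1 = 0" by (rule rational_multiple_eps[OF _ *]) (use th len in simp)
    then have "len - th = of_int (m + 1)" using * by simp
    then have "0 < real_of_int (m + 1)" "real_of_int (m + 1) < 1" using th l_less_1 by linarith+
    then show False by (simp only: of_int_0_less_iff of_int_less_1_iff)
  qed
qed

lemma rev_word_in_iet3:
  assumes "r \<le> N"
  shows "rev (word r) \<in> iet3 N"
proof -
  have avoid: "(T ^^ i) (start r) \<notin> {0, len - 1 + eps, eps}" if "i \<le> N" for i
    using orbit_avoids_endpoints[OF assms that] .
  have "0 \<le> (T ^^ N) (start r)" "(T ^^ N) (start r) < len" "(T ^^ N) (start r) \<noteq> 0"
    using T_pow_in[OF start(1)[of r], of N] avoid[of N] by auto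
  then have "len - (T ^^ N) (start r) \<in> {0..<len}" by simp
  then show ?thesis
    using orbit_word_in_iet3[OF admissible] rev_orbit_word[OF start(1)[of r] avoid]
    unfolding word_def by simp
qed

lemma lattice_point:
  fixes m n :: int
  assumes "\<bar>n\<bar> \<le> 2 * int N"
  shows "\<bar>th + m - n * eps - of_int (m * int q - n * int p) * mesh\<bar> \<le> mesh / 8"
proof -
  have "th + m - n * eps - of_int (m * int q - n * int p) * mesh = th - n * eta"
    using q_pos by (simp add: eps_def mesh_def field_simps)
  moreover have "\<bar>real_of_int n\<bar> \<le> 2 * real N" using assms by linarith
  ultimately show ?thesis using small_perturbation[of "real_of_int n"] th_pos unfolding abs_le_iff by auto
qed

text \<open>A point this low belongs to the lattice point 0, so \<open>q\<close> divides its step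
  count. Such points have the form \<open>th - t * (q * eta)\<close>, and only \<open>t = 0\<close>
  falls into \<open>[0, q * eta)\<close>.\<close>

lemma orbit_near_zero:
  assumes "r \<le> N" "i \<le> N" "(T ^^ i) (start r) < q * eta"
  shows "i = r"
proof -
  obtain m n :: int where n: "\<bar>n\<bar> \<le> 2 * int N" and y: "(T ^^ i) (start r) = th + m - n * eps"
    and z: "n = 0 \<Longrightarrow> i = r" using orbit_lattice[OF assms(1,2)] by blast
  define j where "j = m * int q - n * int p"
  have y0: "0 \<le> (T ^^ i) (start r)" using T_pow_in[OF start(1)[of r], of i] by simp
  have b: "\<bar>(T ^^ i) (start r) - of_int j * mesh\<bar> \<le> mesh / 8"
    unfolding y j_def by (rule lattice_point[OF n])
  have "of_int j * mesh < 1 * mesh" "(-1) * mesh < of_int j * mesh"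
    using b y0 assms(3) q_mult_eta(2) mesh_pos unfolding abs_le_iff by linarith+
  then have "real_of_int j < 1" "-1 < real_of_int j"
    using mesh_pos by (meson less_imp_le mult_right_less_imp_less)+
  then have j0: "j = 0" by linarith
  then have "int q dvd n * int p" unfolding j_def by (metis diff_eq_eq add_0 dvd_triv_right)
  then have "int q dvd n" using cop by (simp add: coprime_dvd_mult_left_iff coprime_commute)
  then obtain t where t: "n = int q * t" ..
  have "m = t * int p"
    using j0 q_pos t unfolding j_def by simp
  then have "(T ^^ i) (start r) = th - t * (q * eps - p)"
    using y t by (simp add: algebra_simps)
  then have yt: "(T ^^ i) (start r) = th - t * (q * eta)" using q_mult_eta(1) by simp
  have qe: "0 < q * eta" using q_mult_eta(3) th_pos by linarith
  have "t = 0"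
  proof (rule ccontr)
    assume "t \<noteq> 0"
    then consider "1 \<le> t" | "t \<le> -1" by linarith
    then show False
    proof cases
      case 1
      then have "1 * (q * eta) \<le> of_int t * (q * eta)" using qe by (intro mult_right_mono) auto
      then show ?thesis using yt y0 q_mult_eta(3) by linarith
    next
      case 2
      then have "of_int t * (q * eta) \<le> (-1) * (q * eta)" using qe by (intro mult_right_mono) linarith+
      then show ?thesis using yt assms(3) th_pos by linarith
    qed
  qed
  then show ?thesis using t z by simp
qed

text \<open>The last lattice point below \<open>len\<close> is \<open>(L - 1) * mesh\<close>, half a
  mesh below it, and the perturbation and \<open>q * eta\<close> together do not bridge that
  distance.\<close>

lemma orbit_away_from_len:
  assumes "r \<le> N" "i \<le> N"
  shows "(T ^^ i) (start r) < len - q * eta"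
proof (rule ccontr)
  assume c: "\<not> ?thesis"
  obtain m n :: int where n: "\<bar>n\<bar> \<le> 2 * int N" and y: "(T ^^ i) (start r) = th + m - n * eps"
    using orbit_lattice[OF assms(1,2)] by blast
  define j where "j = m * int q - n * int p"
  have b: "\<bar>(T ^^ i) (start r) - of_int j * mesh\<bar> \<le> mesh / 8"
    unfolding y j_def by (rule lattice_point[OF n])
  have ylen: "(T ^^ i) (start r) < len" using T_pow_in[OF start(1)[of r], of i] by simp
  have len: "len = real L * mesh - mesh / 2" by (simp add: len_eq mesh_def)
  have "of_int j * mesh < real L * mesh"
    using b ylen mesh_pos unfolding abs_le_iff len by linarith
  then have "real_of_int j < real L" using mesh_pos by simp
  then have "j \<le> int L - 1" by linarith
  then have "of_int j \<le> real L - 1" by linarith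
  then have "of_int j * mesh \<le> (real L - 1) * mesh" using mesh_pos by (intro mult_right_mono) auto
  then have "of_int j * mesh \<le> real L * mesh - mesh" by (simp add: algebra_simps)
  then show False using c b q_mult_eta(2) mesh_pos unfolding abs_le_iff len by linarith
qed

section \<open>Recovering \<open>p\<close>, \<open>q\<close>, \<open>r\<close> and \<open>L\<close>
  from a word\<close>

lemma fraction_le:
  assumes "q' \<le> 2 * N" "real p' < real q' * eps"
  shows "p' * q \<le> p * q'"
proof -
  have "real q' * eta \<le> mesh / 16" using small_perturbation(1)[of q'] assms(1) by auto
  then have "real p' < real q' * (real p / real q) + mesh / 16"
    using assms(2) by (simp add: eps_def distrib_left)
  then have "real p' * real q < real q' * real p + 1 / 16"
    using q_pos by (simp add: mesh_def field_simps)
  \<comment> \<open>The cross products are integers, so an excess below \<open>1 / 16\<close> is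
    none at all. Hence \<open>p / q\<close> is the largest fraction below \<open>eps\<close> with
    denominator at most \<open>2 * N\<close>.\<close>
  then have "real (p' * q) < real (p * q' + 1)" by (simp add: mult.commute)
  then show ?thesis by linarith
qed

lemma marks_word_le:
  assumes "marks (word r) p' q' r' L'" "q' \<le> 2 * N"
  shows "p' * q \<le> p * q'"
proof (rule fraction_le)
  show "real p' < real q' * eps"
    using marks_bounds[OF start(1) assms(1)[unfolded word_def]] T_pow_in[OF start(1)[of r], of r'] by simp
qed fact

lemma marks_rev_word_le:
  assumes "marks (rev (word r)) p' q' r' L'" "q' \<le> 2 * N"
  shows "p' * q \<le> p * q'"
proof (rule fraction_le)
  obtain i where "len - (q' * eps - p') \<le> (T ^^ i) (start r)"
    by (rule marks_rev_bounds[OF start(1) assms(1)[unfolded word_def]])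
  then show "real p' < real q' * eps" using T_pow_in[OF start(1)[of r], of i] by simp
qed fact

text \<open>The position is found because the orbit comes this close to 0 only once. The length
  follows since the step count grows strictly and has to equal \<open>q + 1\<close>.\<close>

lemma marks_word_unique:
  assumes "marks (word r) p q r' L'" "r + L \<le> N"
  shows "r' = r \<and> L' = L"
proof -
  have "r' \<le> N" using assms(1) by (simp add: marks_def word_def)
  moreover have "(T ^^ r') (start r) < q * eta"
    using marks_bounds[OF start(1) assms(1)[unfolded word_def]] q_mult_eta(1) by simp
  ultimately have r: "r' = r" using assms(2) by (intro orbit_near_zero) auto
  moreover have "L' = L"
    using assms(1) marks_word[OF assms(2)] r stepss_strict_mono[of r "r + L" "r + L'" "word r"]
      stepss_strict_mono[of r "r + L'" "r + L" "word r"]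
    by (cases L L' rule: linorder_cases) (auto simp: marks_def)
  ultimately show ?thesis by simp
qed

text \<open>A mark of the same fraction in the reversal would bring the orbit within
  \<open>q * eta\<close> of \<open>len\<close>.\<close>

lemma not_marks_rev_word:
  assumes "r \<le> N"
  shows "\<not> marks (rev (word r)) p q r' L'"
proof
  assume "marks (rev (word r)) p q r' L'"
  then obtain i where "i \<le> N" "len - (q * eps - p) \<le> (T ^^ i) (start r)"
    unfolding word_def by (rule marks_rev_bounds[OF start(1)])
  then show False using orbit_away_from_len[OF assms, of i] q_mult_eta(1) by simp
qed

end

section \<open>Reduced fractions, and coprime pairs in a triangle\<close>

lemma coprime_fractions_eq:
  fixes p q p' q' :: nat
  assumes "coprime p q" "coprime p' q'" "p' * q = p * q'"
  shows "p' = p \<and> q' = q"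
proof -
  have "p' dvd p * q'" "p dvd p' * q" "q dvd p * q'" "q' dvd p' * q"
    using dvd_triv_left[of p' q] dvd_triv_left[of p q'] dvd_triv_right[of q p'] dvd_triv_right[of q' p]
    unfolding assms(3) by simp_all
  then have "p' dvd p" "p dvd p'" "q dvd q'" "q' dvd q"
    using assms(1,2) by (simp_all add: coprime_dvd_mult_left_iff coprime_dvd_mult_right_iff coprime_commute)
  then show ?thesis by (simp add: dvd_antisym)
qed

text \<open>A pair \<open>(a, b)\<close> stands for \<open>(p, q - p)\<close> and \<open>m\<close>
  for \<open>L - 1\<close>: the bounds by \<open>m\<close> say \<open>p < L\<close> and
  \<open>q < p + L\<close>, and \<open>m < a + b\<close> says \<open>L \<le> q\<close>.\<close>

definition triangle :: "nat \<Rightarrow> (nat \<times> nat) set" where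
  "triangle m = {(a, b). a \<in> {1..m} \<and> b \<in> {1..m} \<and> m < a + b}"

definition coprime_triangle :: "nat \<Rightarrow> (nat \<times> nat) set" where
  "coprime_triangle m = {(a, b) \<in> triangle m. coprime a b}"

lemma finite_triangle [simp]: "finite (triangle m)"
  by (rule finite_subset[of _ "{1..m} \<times> {1..m}"]) (auto simp: triangle_def)

lemma finite_coprime_triangle [simp]: "finite (coprime_triangle m)"
  by (rule finite_subset[OF _ finite_triangle[of m]]) (auto simp: coprime_triangle_def)

lemma card_triangle: "2 * card (triangle m) = m * (m + 1)"
proof -
  have "triangle m = Sigma {1..m} (\<lambda>a. {m + 1 - a..m})"
    by (auto simp: triangle_def)
  then have "card (triangle m) = (\<Sum>a\<in>{1..m}. a)" by simp
  then show ?thesis using gauss_sum_from_Suc_0[of m, where 'a = nat] by simp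
qed

text \<open>Dividing both entries by \<open>d\<close> is injective on these pairs. The condition on
  the sum survives the rounding because \<open>m < d * s\<close> is equivalent to
  \<open>m div d < s\<close>.\<close>

lemma card_triangle_multiples_le:
  assumes "0 < d"
  shows "card {(a, b) \<in> triangle m. d dvd a \<and> d dvd b} \<le> card (triangle (m div d))"
proof (rule card_inj_on_le)
  show "inj_on (\<lambda>(a, b). (a div d, b div d)) {(a, b) \<in> triangle m. d dvd a \<and> d dvd b}"
    using assms by (auto simp: inj_on_def elim!: dvdE)
  show "(\<lambda>(a, b). (a div d, b div d)) ` {(a, b) \<in> triangle m. d dvd a \<and> d dvd b} \<subseteq> triangle (m div d)"
  proof safe
    fix a b assume ab: "(a, b) \<in> triangle m" and "d dvd a" "d dvd b"
    then obtain a' b' where [simp]: "a = d * a'" "b = d * b'" by (auto elim!: dvdE)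
    have "m div d < a' + b'"
      using ab assms by (simp add: triangle_def div_less_iff_less_mult distrib_left mult.commute)
    moreover have "a' \<le> m div d" "b' \<le> m div d"
      using ab assms by (auto simp: triangle_def less_eq_div_iff_mult_less_eq mult.commute)
    ultimately show "(a div d, b div d) \<in> triangle (m div d)"
      using ab assms by (auto simp: triangle_def intro!: Suc_leI gr0I)
  qed
qed simp

text \<open>Completing a square absorbs the linear terms, so that no harmonic sum appears.\<close>

lemma card_triangle_div_le: "real (card (triangle (m div d))) \<le> 21 / 40 * (real m)\<^sup>2 / (real d)\<^sup>2 + 5 / 2"
proof -
  define k where "k = real (m div d)"
  have "2 * real (card (triangle (m div d))) = k * (k + 1)"
    using arg_cong[OF card_triangle[of "m div d"], of real] by (simp add: k_def algebra_simps)
  moreover have "0 \<le> (k - 10)\<^sup>2" by simp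
  then have "k * (k + 1) \<le> 21 / 20 * k\<^sup>2 + 5" by (simp add: power2_eq_square algebra_simps)
  moreover have "k\<^sup>2 \<le> (real m / real d)\<^sup>2"
    unfolding k_def by (intro power_mono of_nat_div_le_of_nat) simp
  ultimately show ?thesis by (simp add: power_divide)
qed

text \<open>Since \<open>(2 * k + 1)\<^sup>2\<close> exceeds \<open>4 * k * (k + 1)\<close>, a
  telescoping series dominates; the induction carries its remainder.\<close>

lemma sum_inverse_odd_squares_le: "(\<Sum>k\<in>{1..n}. 1 / (real (2 * k + 1))\<^sup>2) \<le> 1 / 4"
proof -
  have "(\<Sum>k\<in>{1..n}. 1 / (real (2 * k + 1))\<^sup>2) \<le> 1 / 4 - 1 / (4 * real (n + 1))"
  proof (induction n)
    case (Suc n)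
    have "1 / (real (2 * Suc n + 1))\<^sup>2 \<le> 1 / (4 * real (n + 1) * real (n + 2))"
      by (intro frac_le mult_pos_pos) (simp_all add: power2_eq_square algebra_simps)
    also have "\<dots> = 1 / (4 * real (n + 1)) - 1 / (4 * real (Suc n + 1))"
    proof -
      have "1 / (4 * x * (x + 1)) = 1 / (4 * x) - 1 / (4 * (x + 1))" if "0 < x" for x :: real
        using that by (simp add: divide_simps)
      from this[of "real (n + 1)"] show ?thesis by (simp add: add.assoc)
    qed
    finally show ?case using Suc by simp
  qed simp
  also have "\<dots> \<le> 1 / 4" by simp
  finally show ?thesis .
qed

text \<open>A pair that is not coprime has 2 or an odd number \<open>2 * k + 1 \<ge> 3\<close> as a common divisor.\<close>

lemma card_coprime_triangle_ge:
  "real (card (coprime_triangle m)) \<ge> 19 / 80 * (real m)\<^sup>2 - 2 * real m - 5 / 2"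
proof -
  define D where "D d = {(a, b) \<in> triangle m. d dvd a \<and> d dvd b}" for d
  have fin: "finite (D d)" for d
    unfolding D_def by (rule finite_subset[OF _ finite_triangle[of m]]) auto
  have D: "real (card (D d)) \<le> 21 / 40 * (real m)\<^sup>2 / (real d)\<^sup>2 + 5 / 2" if "0 < d" for d
    using card_triangle_multiples_le[OF that, of m] card_triangle_div_le[of m d] unfolding D_def by linarith
  have "triangle m \<subseteq> coprime_triangle m \<union> (D 2 \<union> (\<Union>k\<in>{1..m}. D (2 * k + 1)))"
  proof
    fix x assume x: "x \<in> triangle m"
    obtain a b where [simp]: "x = (a, b)" by fastforce
    show "x \<in> coprime_triangle m \<union> (D 2 \<union> (\<Union>k\<in>{1..m}. D (2 * k + 1)))"
    proof (cases "coprime a b")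
      case True
      then show ?thesis using x by (simp add: coprime_triangle_def)
    next
      case False
      define g where "g = gcd a b"
      have g: "g dvd a" "g dvd b" "g \<noteq> 1" using False by (auto simp: g_def coprime_iff_gcd_eq_1)
      show ?thesis
      proof (cases "even g")
        case True
        then have "2 dvd a" "2 dvd b" using g by (meson dvd_trans)+
        then have "x \<in> D 2" using x by (simp add: D_def)
        then show ?thesis by blast
      next
        case odd: False
        then obtain k where k: "g = 2 * k + 1" by (elim oddE)
        have "g \<le> m" using g x by (auto simp: triangle_def dest!: dvd_imp_le)
        then have "k \<in> {1..m}" using k g by auto
        moreover have "x \<in> D (2 * k + 1)" using g x unfolding k by (simp add: D_def)
        ultimately show ?thesis by blast
      qed
    qed
  qed
  then have "card (triangle m) \<le> card (coprime_triangle m \<union> (D 2 \<union> (\<Union>k\<in>{1..m}. D (2 * k + 1))))"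
    using fin by (intro card_mono) auto
  also have "\<dots> \<le> card (coprime_triangle m) + (card (D 2) + card (\<Union>k\<in>{1..m}. D (2 * k + 1)))"
    by (meson add_left_mono card_Un_le order_trans)
  also have "\<dots> \<le> card (coprime_triangle m) + (card (D 2) + (\<Sum>k\<in>{1..m}. card (D (2 * k + 1))))"
    by (intro add_left_mono card_UN_le) simp
  finally have "real (card (triangle m)) \<le>
      card (coprime_triangle m) + (card (D 2) + (\<Sum>k\<in>{1..m}. real (card (D (2 * k + 1)))))"
    by (simp flip: of_nat_sum of_nat_add)
  moreover have "(\<Sum>k\<in>{1..m}. real (card (D (2 * k + 1)))) \<le>
      (\<Sum>k\<in>{1..m}. 21 / 40 * (real m)\<^sup>2 * (1 / (real (2 * k + 1))\<^sup>2) + 5 / 2)"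
    using D by (intro sum_mono) (simp del: of_nat_add of_nat_mult of_nat_Suc)
  moreover have "\<dots> = 21 / 40 * (real m)\<^sup>2 * (\<Sum>k\<in>{1..m}. 1 / (real (2 * k + 1))\<^sup>2) + 5 / 2 * m"
    by (simp only: sum.distrib sum_distrib_left) simp
  moreover have "\<dots> \<le> 21 / 40 * (real m)\<^sup>2 * (1 / 4) + 5 / 2 * m"
    by (intro add_right_mono mult_left_mono sum_inverse_odd_squares_le) simp
  moreover have "real (card (D 2)) \<le> 21 / 160 * (real m)\<^sup>2 + 5 / 2" using D[of 2] by simp
  moreover have "real (card (triangle m)) = (real m)\<^sup>2 / 2 + real m / 2"
    using arg_cong[OF card_triangle[of m], of real] by (simp add: power2_eq_square algebra_simps)
  \<comment> \<open>The divisor 2 and the odd divisors each cost \<open>21 / 160\<close> of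
    \<open>m\<^sup>2\<close>, and \<open>1 / 2 - 2 * 21 / 160 = 19 / 80\<close>.\<close>
  ultimately show ?thesis by linarith
qed

section \<open>The number of parameter tuples, to leading order\<close>

lemma sum_diff_mult_square:
  "(\<Sum>k<n. (c - real k) * (real k)\<^sup>2) =
     c * (real n * (real n - 1) * (2 * real n - 1)) / 6 - (real n * (real n - 1) / 2)\<^sup>2"
  by (induction n) (simp_all add: power2_eq_square field_simps)

text \<open>A tuple \<open>(m, r, a, b)\<close> encodes \<open>L = m + 1\<close>, the position
  \<open>r\<close>, \<open>p = a\<close> and \<open>q = a + b\<close>; the range of \<open>r\<close>
  says \<open>r + L \<le> n\<close>.\<close>

definition parameters :: "nat \<Rightarrow> (nat \<times> nat \<times> nat \<times> nat) set" where
  "parameters n = Sigma {..<n} (\<lambda>m. {..<n - m} \<times> coprime_triangle m)"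

lemma finite_parameters [simp]: "finite (parameters n)"
  by (simp add: parameters_def)

lemma card_parameters_ge:
  "2 * real (card (parameters n)) \<ge> 19 / 480 * real n ^ 4 - 10 * real n ^ 3"
proof (cases "n = 0")
  case False
  then have n: "1 \<le> real n" by simp
  have "(\<Sum>m<n. (real n - real m) * (19 / 80 * (real m)\<^sup>2 - 2 * real m - 5 / 2)) \<le>
      (\<Sum>m<n. (real n - real m) * card (coprime_triangle m))"
    by (intro sum_mono mult_left_mono card_coprime_triangle_ge) simp
  also have "\<dots> = real (card (parameters n))"
    by (simp add: parameters_def of_nat_diff)
  finally have le: "(\<Sum>m<n. (real n - real m) * (19 / 80 * (real m)\<^sup>2 - 2 * real m - 5 / 2)) \<le>
      real (card (parameters n))" .
  \<comment> \<open>The lower-order terms are bounded crudely in each summand, which costs only a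
    cubic term. The main sum is \<open>(n ^ 4 - n\<^sup>2) / 12\<close>, whence
    \<open>19 / 960\<close>, doubled to \<open>19 / 480\<close>.\<close>
  have "19 / 80 * (\<Sum>m<n. (real n - real m) * (real m)\<^sup>2) - (\<Sum>m<n. 2 * (real n)\<^sup>2 + 5 / 2 * real n) =
      (\<Sum>m<n. (real n - real m) * (19 / 80 * (real m)\<^sup>2) - (2 * (real n)\<^sup>2 + 5 / 2 * real n))"
    by (simp only: sum_distrib_left sum_subtractf mult.left_commute)
  also have "\<dots> \<le> (\<Sum>m<n. (real n - real m) * (19 / 80 * (real m)\<^sup>2 - 2 * real m - 5 / 2))"
  proof (rule sum_mono)
    fix m assume "m \<in> {..<n}"
    define X Y where "X = (real n - real m) * (19 / 80 * (real m)\<^sup>2)" and "Y = (real n - real m) * real m"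
    have "0 \<le> real m" by simp
    moreover have "Y \<le> (real n)\<^sup>2"
      unfolding Y_def power2_eq_square using \<open>m \<in> {..<n}\<close> by (intro mult_mono) auto
    moreover have eq: "(real n - real m) * (19 / 80 * (real m)\<^sup>2 - 2 * real m - 5 / 2) =
        X - 2 * Y - 5 / 2 * (real n - real m)"
      by (simp add: X_def Y_def algebra_simps)
    ultimately show "(real n - real m) * (19 / 80 * (real m)\<^sup>2) - (2 * (real n)\<^sup>2 + 5 / 2 * real n) \<le>
        (real n - real m) * (19 / 80 * (real m)\<^sup>2 - 2 * real m - 5 / 2)"
      unfolding eq X_def[symmetric] by argo
  qed
  also note le
  finally have "19 / 80 * (real n * (real n * (real n - 1) * (2 * real n - 1)) / 6 - (real n * (real n - 1) / 2)\<^sup>2)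
      - real n * (2 * (real n)\<^sup>2 + 5 / 2 * real n) \<le> real (card (parameters n))"
    by (simp add: sum_diff_mult_square)
  moreover have "real n * (real n * (real n - 1) * (2 * real n - 1)) / 6 - (real n * (real n - 1) / 2)\<^sup>2 =
      (real n ^ 4 - (real n)\<^sup>2) / 12"
    by (simp add: power2_eq_square power4_eq_xxxx field_simps)
  moreover have "(real n)\<^sup>2 \<le> real n ^ 3" using n by (intro power_increasing) auto
  moreover have "real n * (2 * (real n)\<^sup>2 + 5 / 2 * real n) = 2 * real n ^ 3 + 5 / 2 * (real n)\<^sup>2"
    by (simp add: power2_eq_square power3_eq_cube field_simps)
  moreover have "0 \<le> (real n)\<^sup>2" by simp
  ultimately show ?thesis by argo
qed simp

section \<open>Distinct words from distinct tuples, and their reversals\<close>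

lemma near_rational_parameters:
  assumes "(m, r, a, b) \<in> parameters n"
  shows "near_rational n (Suc m) a (a + b)" "r + Suc m \<le> n"
  using assms by (auto simp: near_rational_def parameters_def coprime_triangle_def triangle_def coprime_iff_gcd_eq_1)

fun parameter_word :: "nat \<Rightarrow> nat \<times> nat \<times> nat \<times> nat \<Rightarrow> letter list" where
  "parameter_word n (m, r, a, b) = near_rational.word n (Suc m) a (a + b) r"

lemma parameter_word_in_iet3: "x \<in> parameters n \<Longrightarrow> parameter_word n x \<in> iet3 n"
  by (cases x) (auto intro!: near_rational.word_in_iet3 dest: near_rational_parameters)

text \<open>A common word carries the marks of both tuples, so each fraction is at most the other.
  Once the fractions agree, position and length agree too.\<close>

lemma inj_parameter_word: "inj_on (parameter_word n) (parameters n)"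
proof (rule inj_onI)
  fix x y assume xy: "x \<in> parameters n" "y \<in> parameters n" "parameter_word n x = parameter_word n y"
  obtain m r a b where x: "x = (m, r, a, b)" by (cases x)
  obtain m' r' a' b' where y: "y = (m', r', a', b')" by (cases y)
  interpret X: near_rational n "Suc m" a "a + b"
    using xy(1) unfolding x by (rule near_rational_parameters)
  interpret Y: near_rational n "Suc m'" a' "a' + b'"
    using xy(2) unfolding y by (rule near_rational_parameters)
  have r: "r + Suc m \<le> n" "r' + Suc m' \<le> n"
    using xy near_rational_parameters unfolding x y by blast+
  have eq: "X.word r = Y.word r'" using xy(3) by (simp add: x y)
  have 1: "marks (X.word r) a' (a' + b') r' (Suc m')"
    unfolding eq by (rule Y.marks_word[OF r(2)])
  have 2: "marks (Y.word r') a (a + b) r (Suc m)"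
    unfolding eq[symmetric] by (rule X.marks_word[OF r(1)])
  have "a' * (a + b) = a * (a' + b')"
    using X.marks_word_le[OF 1] Y.marks_word_le[OF 2] X.q_le Y.q_le by (intro antisym) auto
  then have ab: "a' = a" "a' + b' = a + b"
    using coprime_fractions_eq[OF X.cop Y.cop] by auto
  then have "r' = r \<and> Suc m' = Suc m"
    using X.marks_word_unique[of r r' "Suc m'"] 1 r(1) by simp
  then show "x = y" using ab by (simp add: x y)
qed

lemma rev_parameter_word_in_iet3: "x \<in> parameters n \<Longrightarrow> rev (parameter_word n x) \<in> iet3 n"
  by (cases x) (auto intro!: near_rational.rev_word_in_iet3 dest: near_rational_parameters)

text \<open>Comparing marks through the reversals again forces equal fractions, but a reversal never
  carries the mark of its own fraction.\<close>

lemma parameter_word_neq_rev: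
  assumes "x \<in> parameters n" "y \<in> parameters n"
  shows "parameter_word n x \<noteq> rev (parameter_word n y)"
proof
  assume eq0: "parameter_word n x = rev (parameter_word n y)"
  obtain m r a b where x: "x = (m, r, a, b)" by (cases x)
  obtain m' r' a' b' where y: "y = (m', r', a', b')" by (cases y)
  interpret X: near_rational n "Suc m" a "a + b"
    using assms(1) unfolding x by (rule near_rational_parameters)
  interpret Y: near_rational n "Suc m'" a' "a' + b'"
    using assms(2) unfolding y by (rule near_rational_parameters)
  have r: "r + Suc m \<le> n" "r' + Suc m' \<le> n"
    using assms near_rational_parameters unfolding x y by blast+
  have eq: "X.word r = rev (Y.word r')" using eq0 by (simp add: x y)
  have 1: "marks (rev (X.word r)) a' (a' + b') r' (Suc m')"
    unfolding eq rev_rev_ident by (rule Y.marks_word[OF r(2)])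
  have 2: "marks (rev (Y.word r')) a (a + b) r (Suc m)"
    unfolding eq[symmetric] by (rule X.marks_word[OF r(1)])
  have "a' * (a + b) = a * (a' + b')"
    using X.marks_rev_word_le[OF 1] Y.marks_rev_word_le[OF 2] X.q_le Y.q_le by (intro antisym) auto
  then have "a' = a" "a' + b' = a + b"
    using coprime_fractions_eq[OF X.cop Y.cop] by auto
  then show False using X.not_marks_rev_word[of r r' "Suc m'"] 1 r(1) by simp
qed

text \<open>Since \<open>card\<close> is 0 on infinite sets, counting a subset bounds
  \<open>card (iet3 n)\<close> only with finiteness.\<close>

lemma finite_iet3: "finite (iet3 n)"
proof -
  have "finite (UNIV :: letter set)"
    by (rule finite_subset[of _ "{A, B, C}"]) (auto intro: letter.exhaust)
  then have "finite {w :: letter list. set w \<subseteq> UNIV \<and> length w = n}"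
    by (rule finite_lists_length_eq)
  then show ?thesis by (rule finite_subset[rotated]) (auto simp: iet3_def)
qed

lemma card_iet3_ge: "2 * card (parameters n) \<le> card (iet3 n)"
proof -
  let ?W = "parameter_word n ` parameters n"
  have "card ?W = card (parameters n)" "card (rev ` ?W) = card (parameters n)"
    using inj_parameter_word by (simp_all add: card_image inj_on_def)
  moreover have "?W \<inter> rev ` ?W = {}" using parameter_word_neq_rev by blast
  ultimately have "card (?W \<union> rev ` ?W) = 2 * card (parameters n)"
    by (subst card_Un_disjoint) auto
  moreover have "?W \<union> rev ` ?W \<subseteq> iet3 n"
    using parameter_word_in_iet3 rev_parameter_word_in_iet3 by blast
  ultimately show ?thesis using card_mono[OF finite_iet3] by metis
qed

theorem mainTheorem2:
  shows "\<forall>\<delta>::real. \<delta> > 0 \<longrightarrow> (\<exists>K::real. K > 0 \<and> (\<forall>N::nat. N \<ge> 1 \<longrightarrow>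
     real (card (iet3 N)) \<ge> 17 / (48 * pi\<^sup>2) * real N ^ 4 - K * real N powr (3 + \<delta>)))"
\<comment> \<open>The constant 10 is the cubic coefficient in \<open>card_parameters_ge\<close>; it
  serves every \<open>\<delta>\<close>.\<close>
proof (intro allI impI exI[of _ 10] conjI)
  fix \<delta> :: real and n :: nat
  assume "0 < \<delta>" "1 \<le> n"
  \<comment> \<open>The crude bound \<open>pi > 3\<close> just suffices: \<open>17 / 432\<close> is
    slightly below \<open>19 / 480\<close>.\<close>
  have "3\<^sup>2 \<le> pi\<^sup>2" using pi_gt3 by (intro power_mono) auto
  then have "17 / (48 * pi\<^sup>2) \<le> 19 / 480" by (simp add: field_simps)
  then have "17 / (48 * pi\<^sup>2) * real n ^ 4 \<le> 19 / 480 * real n ^ 4"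
    by (intro mult_right_mono) auto
  moreover have "real n powr 3 \<le> real n powr (3 + \<delta>)"
    using \<open>0 < \<delta>\<close> \<open>1 \<le> n\<close> by (intro powr_mono) auto
  then have "real n ^ 3 \<le> real n powr (3 + \<delta>)" using \<open>1 \<le> n\<close> by simp
  moreover have "2 * real (card (parameters n)) \<le> real (card (iet3 n))"
    using card_iet3_ge[of n] by linarith
  ultimately show "real (card (iet3 n)) \<ge> 17 / (48 * pi\<^sup>2) * real n ^ 4 - 10 * real n powr (3 + \<delta>)"
    using card_parameters_ge[of n] by linarith
qed simp

end
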